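(* There is a polyhedral realization (with small integer coordinates) in $\mathbb{R}^4$ of a $2$-dimensional $\mathbb{Z}$-acyclic but non-contractible simplicial complex with $23$ vertices.
   Context: A simplicial complex $K$ is called $\mathbb{Z}$-acyclic if its reduced homology with integer coefficients vanishes in all degrees, i.e. $\tilde H_i(K;\mathbb{Z})=0$ for all $i$. It is called contractible if its geometric realization $|K|$ is a contractible topological space, and non-contractible otherwise. A polyhedral realization of a finite simplicial complex $K$ in $\mathbb{R}^d$ is an assignment of a point of $\mathbb{R}^d$ to each vertex of $K$ such that the induced map $|K|\to\mathbb{R}^d$, extended affinely on each simplex, is injective. The coordinates of the realization are the coordinates of the points assigned to the vertices; "with integer coordinates" means that these points lie in $\mathbb{Z}^d$, and "small" is an informal descriptive word with no numerical bound specified in the statement. *)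

theory Defs
  imports
    "HOL-Analysis.Analysis"
    "HOL-Algebra.Elementary_Groups"
    "HOL-Algebra.Free_Abelian_Groups"
begin

text \<open>
  Finite abstract simplicial complexes. The empty simplex (of dimension -1) always belongs to the
  complex; it provides the augmentation of the reduced chain complex below.
\<close>

definition abstract_simplicial_complex :: "'v set set \<Rightarrow> bool" where
  "abstract_simplicial_complex K \<longleftrightarrow>
     K \<noteq> {} \<and> (\<forall>\<sigma>\<in>K. finite \<sigma>) \<and> (\<forall>\<sigma>\<in>K. \<forall>\<tau>. \<tau> \<subseteq> \<sigma> \<longrightarrow> \<tau> \<in> K)"

definition finite_simplicial_complex :: "'v set set \<Rightarrow> bool" where
  "finite_simplicial_complex K \<longleftrightarrow> abstract_simplicial_complex K \<and> finite K"

definition vertices :: "'v set set \<Rightarrow> 'v set" where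
  "vertices K = \<Union>K"

definition simplex_dim :: "'v set \<Rightarrow> int" where
  "simplex_dim \<sigma> = int (card \<sigma>) - 1"

definition complex_dim :: "'v set set \<Rightarrow> int" where
  "complex_dim K = Max (simplex_dim ` K)"

text \<open>
  Reduced simplicial homology with integer coefficients. Every simplex is oriented by the linear
  order of the vertex type; the homology groups do not depend on this order up to isomorphism.
\<close>

definition simplicial_chain_group :: "'v set set \<Rightarrow> int \<Rightarrow> ('v set \<Rightarrow>\<^sub>0 int) monoid" where
  "simplicial_chain_group K i = free_Abelian_group {\<sigma> \<in> K. simplex_dim \<sigma> = i}"

text \<open>
  For \<open>\<sigma> = {v\<^sub>0 < \<dots> < v\<^sub>i}\<close> the coefficient of the facet omitting \<open>v\<^sub>j\<close> is \<open>(-1)^j\<close>; for a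
  vertex this is the augmentation \<open>{v} \<mapsto> {}\<close>.
\<close>

definition simplex_boundary :: "'v::linorder set \<Rightarrow> ('v set \<Rightarrow>\<^sub>0 int)" where
  "simplex_boundary \<sigma> =
     (\<Sum>v\<in>\<sigma>. frag_cmul ((-1) ^ card {u \<in> \<sigma>. u < v}) (frag_of (\<sigma> - {v})))"

definition simplicial_boundary :: "('v::linorder set \<Rightarrow>\<^sub>0 int) \<Rightarrow> ('v set \<Rightarrow>\<^sub>0 int)" where
  "simplicial_boundary = frag_extend simplex_boundary"

definition simplicial_cycles :: "'v::linorder set set \<Rightarrow> int \<Rightarrow> ('v set \<Rightarrow>\<^sub>0 int) set" where
  "simplicial_cycles K i =
     kernel (simplicial_chain_group K i) (simplicial_chain_group K (i - 1)) simplicial_boundary"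

definition simplicial_boundaries :: "'v::linorder set set \<Rightarrow> int \<Rightarrow> ('v set \<Rightarrow>\<^sub>0 int) set" where
  "simplicial_boundaries K i = simplicial_boundary ` carrier (simplicial_chain_group K (i + 1))"

definition reduced_simplicial_homology ::
    "int \<Rightarrow> 'v::linorder set set \<Rightarrow> ('v set \<Rightarrow>\<^sub>0 int) set monoid" where
  "reduced_simplicial_homology i K =
     subgroup_generated (simplicial_chain_group K i) (simplicial_cycles K i)
       Mod simplicial_boundaries K i"

definition Z_acyclic :: "'v::linorder set set \<Rightarrow> bool" where
  "Z_acyclic K \<longleftrightarrow> (\<forall>i. trivial_group (reduced_simplicial_homology i K))"

text \<open>
  The geometric realization, in barycentric coordinates. The topology is the subspace topology of
  the product topology on functions; for a finite complex this is the usual topology of \<open>|K|\<close>.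
\<close>

definition geometric_realization :: "'v set set \<Rightarrow> ('v \<Rightarrow> real) set" where
  "geometric_realization K =
     {x. {v. x v \<noteq> 0} \<in> K \<and> (\<forall>v. 0 \<le> x v) \<and> (\<Sum>v | x v \<noteq> 0. x v) = 1}"

definition affine_extension ::
    "'v set set \<Rightarrow> ('v \<Rightarrow> 'b::real_vector) \<Rightarrow> ('v \<Rightarrow> real) \<Rightarrow> 'b" where
  "affine_extension K p x = (\<Sum>v\<in>vertices K. x v *\<^sub>R p v)"

definition polyhedral_realization :: "'v set set \<Rightarrow> ('v \<Rightarrow> 'b::real_vector) \<Rightarrow> bool" where
  "polyhedral_realization K p \<longleftrightarrow> inj_on (affine_extension K p) (geometric_realization K)"

text \<open>The boundary maps form a chain complex, so the quotients above are homology groups.\<close>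

lemma simplicial_boundary_simplex_boundary:
  fixes \<sigma> :: "'v::linorder set"
  assumes "finite \<sigma>"
  shows "simplicial_boundary (simplex_boundary \<sigma>) = 0"
proof -
  define f where "f = (\<lambda>v w. frag_cmul
     ((-1) ^ card {u \<in> \<sigma>. u < v} * (-1) ^ card {u \<in> \<sigma> - {v}. u < w}) (frag_of (\<sigma> - {v} - {w})))"
  define P where "P = (SIGMA v:\<sigma>. \<sigma> - {v})"
  have anti: "f v w = - f w v" if "v \<in> \<sigma>" "w \<in> \<sigma>" "v < w" for v w
  proof -
    have "{u \<in> \<sigma>. u < w} = insert v {u \<in> \<sigma> - {v}. u < w}"
      using that by auto
    hence 1: "card {u \<in> \<sigma>. u < w} = Suc (card {u \<in> \<sigma> - {v}. u < w})"
      using assms by simp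
    have 2: "{u \<in> \<sigma> - {w}. u < v} = {u \<in> \<sigma>. u < v}"
      using that by auto
    have 3: "\<sigma> - {v} - {w} = \<sigma> - {w} - {v}" by auto
    show ?thesis unfolding f_def 1 2 3 by (simp add: mult.commute)
  qed
  have anti': "f v w = - f w v" if "v \<in> \<sigma>" "w \<in> \<sigma> - {v}" for v w
    using anti[of v w] anti[of w v] that by (cases v w rule: linorder_cases) auto
  have "simplicial_boundary (simplex_boundary \<sigma>) = (\<Sum>v\<in>\<sigma>. \<Sum>w\<in>\<sigma> - {v}. f v w)"
    using assms
    by (simp add: simplicial_boundary_def simplex_boundary_def frag_extend_sum frag_extend_cmul
        frag_cmul_sum f_def)
  also have "\<dots> = (\<Sum>(v, w)\<in>P. f v w)"
    using assms by (simp add: P_def sum.Sigma)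
  finally have eq: "simplicial_boundary (simplex_boundary \<sigma>) = (\<Sum>(v, w)\<in>P. f v w)" .
  have "(\<Sum>(v, w)\<in>P. f v w) = (\<Sum>(v, w)\<in>P. - f w v)"
    by (rule sum.cong) (auto simp: P_def intro: anti')
  also have "\<dots> = (\<Sum>(v, w)\<in>P. - f v w)"
    by (rule sum.reindex_bij_witness[of _ prod.swap prod.swap]) (auto simp: P_def)
  also have "\<dots> = - (\<Sum>(v, w)\<in>P. f v w)"
    by (simp add: sum_negf case_prod_unfold)
  finally have "Poly_Mapping.lookup (\<Sum>(v, w)\<in>P. f v w) t = 0" for t
    by (metis lookup_uminus neg_equal_zero)
  hence "(\<Sum>(v, w)\<in>P. f v w) = 0"
    by (intro poly_mapping_eqI) simp
  with eq show ?thesis by simp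
qed

end

theory Submission
  imports Defs "HOL-Library.Code_Binary_Nat"
begin

text \<open>
  The complex consists of a core on ten vertices and a path of thirteen edges attached to it. The core has
  the homotopy type of the presentation complex of the binary icosahedral group for a presentation with two
  generators and two relators. This group is perfect, and the relation matrix of such a presentation is
  unimodular, so the complex is acyclic; but the group is not trivial, so the complex is not contractible. A
  presentation complex embeds piecewise linearly in \<open>\<real>\<^sup>4\<close> when its discs can be put into two different half
  spaces: the attaching curve of one disc can be made an embedded polygon in a copy of \<open>\<real>\<^sup>3\<close>, and the cone
  over it with an apex far away in the direction of the fourth coordinate is embedded. Simplifying such an
  embedding leads to ten points with coordinates in \<open>{-2, \<dots>, 2}\<close>.

  Each of the three properties is certified by data that can be checked by a finite computation with
  integers. Acyclicity follows from an explicit chain contraction (\<open>Z_acyclic_if_chain_contraction\<close>): the cycle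
  space is spanned by cycles through one vertex, and the contraction lists a filling of each. The linear
  embedding follows from a list of hyperplanes such that any two disjoint simplices are strictly separated
  by one of them (\<open>polyhedral_realization_if_separated\<close>). For the fundamental group, the homomorphism onto the
  alternating group of degree five gives a covering with five sheets; over a contractible space it
  would have a section, but going around a certain closed edge path with three edges moves all
  five sheets (\<open>not_contractible_if_monodromy\<close>).
\<close>

section \<open>Chain contractions and acyclicity\<close>

lemma keys_simplex_boundary:
  assumes "abstract_simplicial_complex K" "\<sigma> \<in> K"
  shows "Poly_Mapping.keys (simplex_boundary \<sigma>) \<subseteq> {\<tau> \<in> K. simplex_dim \<tau> = simplex_dim \<sigma> - 1}"
proof -
  have fin: "finite \<sigma>" and faces: "\<And>\<tau>. \<tau> \<subseteq> \<sigma> \<Longrightarrow> \<tau> \<in> K"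
    using assms by (auto simp: abstract_simplicial_complex_def)
  have "Poly_Mapping.keys (simplex_boundary \<sigma>)
      \<subseteq> (\<Union>v\<in>\<sigma>. Poly_Mapping.keys (frag_cmul ((-1) ^ card {u \<in> \<sigma>. u < v}) (frag_of (\<sigma> - {v}))))"
    unfolding simplex_boundary_def by (rule keys_sum)
  also have "\<dots> \<subseteq> {\<sigma> - {v} |v. v \<in> \<sigma>}"
    by auto
  also have "\<dots> \<subseteq> {\<tau> \<in> K. simplex_dim \<tau> = simplex_dim \<sigma> - 1}"
  proof (clarify)
    fix v assume v: "v \<in> \<sigma>"
    have "card \<sigma> > 0" using v fin by (metis card_gt_0_iff empty_iff)
    moreover have "card (\<sigma> - {v}) = card \<sigma> - 1" using v fin by simp
    ultimately show "\<sigma> - {v} \<in> K \<and> simplex_dim (\<sigma> - {v}) = simplex_dim \<sigma> - 1"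
      using faces[of "\<sigma> - {v}"] by (auto simp: simplex_dim_def)
  qed
  finally show ?thesis .
qed

lemma keys_frag_extend_graded:
  assumes "\<And>\<sigma>. \<sigma> \<in> A \<Longrightarrow> Poly_Mapping.keys (f \<sigma>) \<subseteq> B" "Poly_Mapping.keys c \<subseteq> A"
  shows "Poly_Mapping.keys (frag_extend f c) \<subseteq> B"
  using keys_frag_extend[of f c] assms by fastforce

lemma frag_extend_eq_self:
  assumes "\<And>\<sigma>. \<sigma> \<in> Poly_Mapping.keys c \<Longrightarrow> f \<sigma> = frag_of \<sigma>"
  shows "frag_extend f c = c"
  by (metis assms frag_expansion frag_extend_eq)

lemma frag_extend_frag_extend: "frag_extend f (frag_extend g c) = frag_extend (frag_extend f \<circ> g) c"
  using subset_UNIV by (induction c rule: frag_induction) (auto simp: frag_extend_diff)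

lemma frag_extend_plus: "frag_extend f c + frag_extend g c = frag_extend (\<lambda>x. f x + g x) c"
  using subset_UNIV by (induction c rule: frag_induction) (auto simp: frag_extend_diff algebra_simps)

lemma simplicial_boundary_simplicial_boundary:
  assumes "abstract_simplicial_complex K" "Poly_Mapping.keys c \<subseteq> K"
  shows "simplicial_boundary (simplicial_boundary c) = 0"
proof -
  have "simplicial_boundary (simplicial_boundary c)
      = frag_extend (simplicial_boundary \<circ> simplex_boundary) c"
    by (simp add: simplicial_boundary_def frag_extend_frag_extend)
  also have "\<dots> = frag_extend (\<lambda>_. 0) c"
    using assms by (intro frag_extend_eq)
      (auto simp: abstract_simplicial_complex_def intro!: simplicial_boundary_simplex_boundary)
  finally show ?thesis by (simp add: frag_extend_def)
qed

text \<open>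
  The quotient is trivial as soon as every cycle bounds; that boundaries are cycles is needed as well,
  because only then is the quotient by the boundaries formed inside the group of cycles.
\<close>

lemma trivial_reduced_simplicial_homology:
  fixes K :: "'v::linorder set set"
  assumes K: "abstract_simplicial_complex K"
    and exact: "simplicial_cycles K i \<subseteq> simplicial_boundaries K i"
  shows "trivial_group (reduced_simplicial_homology i K)"
proof -
  let ?C = "simplicial_chain_group K i" and ?D = "simplicial_chain_group K (i - 1)"
  let ?Z = "subgroup_generated ?C (simplicial_cycles K i)"
  have carr: "carrier (simplicial_chain_group K j)
      = {c. Poly_Mapping.keys c \<subseteq> {\<sigma> \<in> K. simplex_dim \<sigma> = j}}" for j
    by (auto simp: simplicial_chain_group_def)
  have bd: "simplicial_boundary c \<in> carrier (simplicial_chain_group K (j - 1))"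
    if "c \<in> carrier (simplicial_chain_group K j)" for c j
    using that unfolding carr simplicial_boundary_def mem_Collect_eq
    by (intro keys_frag_extend_graded[of "{\<sigma> \<in> K. simplex_dim \<sigma> = j}"])
      (use keys_simplex_boundary[OF K] in \<open>blast\<close>)
  interpret C: comm_group ?C
    by (simp add: simplicial_chain_group_def abelian_free_Abelian_group)
  interpret D: group ?D
    by (simp add: simplicial_chain_group_def)
  interpret bdh: group_hom ?C ?D simplicial_boundary
  proof
    show "simplicial_boundary \<in> hom ?C ?D"
      by (rule homI) (use bd in \<open>auto simp: simplicial_chain_group_def simplicial_boundary_def
            frag_extend_add\<close>)
  qed
  have sub: "subgroup (simplicial_cycles K i) ?C"
    unfolding simplicial_cycles_def by (rule bdh.subgroup_kernel)
  have "simplicial_boundaries K i \<subseteq> simplicial_cycles K i"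
  proof
    fix z assume "z \<in> simplicial_boundaries K i"
    then obtain c where c: "c \<in> carrier (simplicial_chain_group K (i + 1))"
      and z: "z = simplicial_boundary c"
      by (auto simp: simplicial_boundaries_def)
    have "simplicial_boundary z = 0"
      unfolding z by (rule simplicial_boundary_simplicial_boundary[OF K]) (use c carr in auto)
    with bd[OF c] show "z \<in> simplicial_cycles K i"
      by (simp add: simplicial_cycles_def kernel_def z) (simp add: simplicial_chain_group_def)
  qed
  with exact have eq: "simplicial_boundaries K i = carrier ?Z"
    using subgroup.carrier_subgroup_generated_subgroup[OF sub] by simp
  interpret Z: group ?Z by (rule C.group_subgroup_generated)
  interpret Q: group "?Z Mod carrier ?Z"
    by (rule normal.factorgroup_is_group[OF Z.normal_self])
  have "carrier (?Z Mod carrier ?Z) \<subseteq> {carrier ?Z}"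
    by (auto simp: FactGroup_def RCOSETS_def Z.coset_join2 Z.subgroup_self)
  then have "trivial_group (?Z Mod carrier ?Z)"
    by (auto simp: Q.trivial_group_alt)
  then show ?thesis
    by (simp add: reduced_simplicial_homology_def eq)
qed

text \<open>
  A chain contraction \<open>h\<close> satisfies \<open>\<partial>h + h\<partial> = id\<close>, so a cycle \<open>z\<close> equals \<open>\<partial>(h z)\<close>. By linearity it is
  enough to know the identity on single simplices, which makes acyclicity of a finite complex a finite
  computation once \<open>h\<close> has been written down.
\<close>

lemma Z_acyclic_if_chain_contraction:
  fixes h :: "'v::linorder set \<Rightarrow> ('v set \<Rightarrow>\<^sub>0 int)"
  assumes K: "abstract_simplicial_complex K"
    and deg: "\<And>\<sigma>. \<sigma> \<in> K \<Longrightarrow>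
      Poly_Mapping.keys (h \<sigma>) \<subseteq> {\<tau> \<in> K. simplex_dim \<tau> = simplex_dim \<sigma> + 1}"
    and contr: "\<And>\<sigma>. \<sigma> \<in> K \<Longrightarrow>
      simplicial_boundary (h \<sigma>) + frag_extend h (simplex_boundary \<sigma>) = frag_of \<sigma>"
  shows "Z_acyclic K"
  unfolding Z_acyclic_def
proof (intro allI trivial_reduced_simplicial_homology[OF K] subsetI)
  fix i z assume "z \<in> simplicial_cycles K i"
  then have keys: "Poly_Mapping.keys z \<subseteq> {\<sigma> \<in> K. simplex_dim \<sigma> = i}"
    and cyc: "simplicial_boundary z = 0"
    by (auto simp: simplicial_cycles_def kernel_def simplicial_chain_group_def)
  have "simplicial_boundary (frag_extend h z) + frag_extend h (simplicial_boundary z)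
      = frag_extend (\<lambda>\<sigma>. simplicial_boundary (h \<sigma>) + frag_extend h (simplex_boundary \<sigma>)) z"
    by (simp add: simplicial_boundary_def frag_extend_frag_extend frag_extend_plus o_def)
  also have "\<dots> = z"
    by (rule frag_extend_eq_self) (use keys contr in auto)
  finally have "z = simplicial_boundary (frag_extend h z)"
    using cyc by (simp add: frag_extend_def)
  moreover have "Poly_Mapping.keys (frag_extend h z) \<subseteq> {\<tau> \<in> K. simplex_dim \<tau> = i + 1}"
    by (rule keys_frag_extend_graded[OF _ keys]) (use deg in fastforce)
  ultimately show "z \<in> simplicial_boundaries K i"
    by (auto simp: simplicial_boundaries_def simplicial_chain_group_def)
qed

section \<open>Separated simplices and linear embeddings\<close>

text \<open>
  If two points \<open>x \<noteq> y\<close> of the realization have the same image, then \<open>x - y\<close> is an affine dependence among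
  the images of the vertices. Its positive and its negative part are supported on faces of the carriers of
  \<open>x\<close> and \<open>y\<close>, hence on two disjoint simplices of the complex whose convex hulls meet. So only pairs of
  disjoint simplices have to be separated, and no affine independence has to be checked separately:
  disjoint faces of one simplex are among those pairs.
\<close>

lemma polyhedral_realization_if_separated:
  fixes p :: "'v \<Rightarrow> 'b::real_inner"
  assumes K: "finite_simplicial_complex K"
    and sep: "\<And>\<sigma> \<tau>. \<sigma> \<in> K \<Longrightarrow> \<tau> \<in> K \<Longrightarrow> \<sigma> \<noteq> {} \<Longrightarrow> \<tau> \<noteq> {} \<Longrightarrow> \<sigma> \<inter> \<tau> = {} \<Longrightarrow>
      \<exists>a b. (\<forall>v\<in>\<sigma>. a \<bullet> p v > b) \<and> (\<forall>v\<in>\<tau>. a \<bullet> p v < b)"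
  shows "polyhedral_realization K p"
  unfolding polyhedral_realization_def
proof (rule inj_onI, rule ccontr)
  fix x y assume x: "x \<in> geometric_realization K" and y: "y \<in> geometric_realization K"
    and eq: "affine_extension K p x = affine_extension K p y" and "x \<noteq> y"
  have finV: "finite (vertices K)" and down: "\<And>\<sigma> \<tau>. \<sigma> \<in> K \<Longrightarrow> \<tau> \<subseteq> \<sigma> \<Longrightarrow> \<tau> \<in> K"
    using K by (auto simp: finite_simplicial_complex_def abstract_simplicial_complex_def vertices_def)
  have sum1: "(\<Sum>v\<in>vertices K. z v) = 1" and supp: "{v. z v \<noteq> 0} \<in> K"
    and nn: "\<And>v. 0 \<le> z v" and out: "\<And>v. v \<notin> vertices K \<Longrightarrow> z v = 0"
    if "z \<in> geometric_realization K" for z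
  proof -
    from that have *: "{v. z v \<noteq> 0} \<in> K" "\<And>v. 0 \<le> z v" "(\<Sum>v | z v \<noteq> 0. z v) = 1"
      by (auto simp: geometric_realization_def)
    then show "{v. z v \<noteq> 0} \<in> K" "\<And>v. 0 \<le> z v" by auto
    show "\<And>v. v \<notin> vertices K \<Longrightarrow> z v = 0" using *(1) by (auto simp: vertices_def)
    have "(\<Sum>v | z v \<noteq> 0. z v) = (\<Sum>v\<in>vertices K. z v)"
      by (rule sum.mono_neutral_left[OF finV]) (use *(1) in \<open>auto simp: vertices_def\<close>)
    with * show "(\<Sum>v\<in>vertices K. z v) = 1" by simp
  qed
  \<comment> \<open>the supports of the positive and of the negative part of \<open>x - y\<close>\<close>
  define P where "P = {v. y v < x v}"
  define Q where "Q = {v. x v < y v}"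
  have "P \<subseteq> {v. x v \<noteq> 0}" "Q \<subseteq> {v. y v \<noteq> 0}"
    using nn[OF x] nn[OF y] by (auto simp: P_def Q_def) (metis leD)+
  then have PK: "P \<in> K" and QK: "Q \<in> K" using down supp x y by blast+
  have sum0: "(\<Sum>v\<in>vertices K. x v - y v) = 0"
    using sum1 x y by (simp add: sum_subtractf)
  have "P \<noteq> {}"
  proof
    assume "P = {}"
    then have "\<And>v. y v - x v \<ge> 0" by (force simp: P_def not_less)
    moreover have "(\<Sum>v\<in>vertices K. y v - x v) = 0" using sum0 by (simp add: sum_subtractf)
    ultimately have "\<forall>v\<in>vertices K. y v - x v = 0" using finV by (simp add: sum_nonneg_eq_0_iff)
    then have "x v = y v" for v using out[OF x, of v] out[OF y, of v] by fastforce
    then have "x = y" by blast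
    with \<open>x \<noteq> y\<close> show False by simp
  qed
  have "Q \<noteq> {}"
  proof
    assume "Q = {}"
    then have "\<And>v. x v - y v \<ge> 0" by (force simp: Q_def not_less)
    then have "\<forall>v\<in>vertices K. x v - y v = 0" using finV sum0 by (simp add: sum_nonneg_eq_0_iff)
    then have "x v = y v" for v using out[OF x, of v] out[OF y, of v] by fastforce
    then have "x = y" by blast
    with \<open>x \<noteq> y\<close> show False by simp
  qed
  obtain a b where ab: "\<And>v. v \<in> P \<Longrightarrow> a \<bullet> p v > b" "\<And>v. v \<in> Q \<Longrightarrow> a \<bullet> p v < b"
    using sep[OF PK QK \<open>P \<noteq> {}\<close> \<open>Q \<noteq> {}\<close>] by (force simp: P_def Q_def)
  obtain w where w: "w \<in> P" using \<open>P \<noteq> {}\<close> by blast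
  have "0 = a \<bullet> (affine_extension K p x - affine_extension K p y) - b * (\<Sum>v\<in>vertices K. x v - y v)"
    by (simp add: eq sum0)
  also have "\<dots> = (\<Sum>v\<in>vertices K. (x v - y v) * (a \<bullet> p v - b))"
    by (simp add: affine_extension_def sum_distrib_left inner_diff_right inner_sum_right
        flip: sum_subtractf) (simp add: algebra_simps)
  also have "\<dots> > 0"
  proof (rule sum_pos2[OF finV])
    show "w \<in> vertices K" using w PK by (auto simp: vertices_def)
    show "0 < (x w - y w) * (a \<bullet> p w - b)" using w ab by (simp add: P_def)
    show "0 \<le> (x v - y v) * (a \<bullet> p v - b)" for v
    proof (cases "x v" "y v" rule: linorder_cases)
      case less then show ?thesis using ab(2)[of v] by (simp add: Q_def mult_nonpos_nonpos)
    next
      case greater then show ?thesis using ab(1)[of v] by (simp add: P_def)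
    qed auto
  qed
  finally show False by simp
qed

section \<open>Coverings from local systems\<close>

text \<open>
  A family of bijections \<open>g u v\<close> of a fibre \<open>F\<close>, one for each pair of vertices and multiplicative on
  simplices, is a local system and defines a covering of the realization with fibre \<open>F\<close>. If the
  realization were contractible, its identity map would lift to the covering, since constant maps lift
  and homotopies can be lifted. Such a section picks a point \<open>l v\<close> of the fibre over each vertex, and along an
  edge \<open>{u, v}\<close> these points correspond under \<open>g u v\<close>. So it suffices that no labelling of the vertices
  is compatible with all edges.

  A point of the covering is a point \<open>x\<close> together with a compatible labelling \<open>l\<close> of its carrier; it is
  encoded by the coordinates \<open>x v\<close>, put at position \<open>(v, l v)\<close>, so that the labels of vertices outside the
  carrier do not matter. Homotopies are lifted in normed spaces; the bijections \<open>b\<close> and \<open>c\<close> serve to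
  move the realization and its covering into \<open>real ^ 'n\<close> and \<open>real ^ 'm\<close>.
\<close>

lemma not_contractible_if_monodromy:
  fixes K :: "'v set set" and g :: "'v \<Rightarrow> 'v \<Rightarrow> 'f \<Rightarrow> 'f" and F :: "'f set"
    and b :: "'n::finite \<Rightarrow> 'v" and c :: "'m::finite \<Rightarrow> 'v \<times> 'f"
  assumes K: "finite_simplicial_complex K" 
    and b: "bij_betw b UNIV (vertices K)"
    and c: "bij_betw c UNIV (vertices K \<times> F)"
    and F: "F \<noteq> {}"
    and gF: "\<And>u v i. i \<in> F \<Longrightarrow> g u v i \<in> F"
    and refl: "\<And>v i. i \<in> F \<Longrightarrow> g v v i = i"
    and cocycle: "\<And>\<sigma> u v w i. \<sigma> \<in> K \<Longrightarrow> u \<in> \<sigma> \<Longrightarrow> v \<in> \<sigma> \<Longrightarrow> w \<in> \<sigma> \<Longrightarrow> i \<in> F \<Longrightarrow>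
      g v w (g u v i) = g u w i"
    and nosec: "\<And>l. \<forall>v\<in>vertices K. l v \<in> F \<Longrightarrow>
      \<forall>u v. {u, v} \<in> K \<longrightarrow> g u v (l u) = l v \<Longrightarrow> False"
  shows "\<not> contractible (geometric_realization K)"
proof
  assume contr: "contractible (geometric_realization K)"
  have V: "finite (vertices K)" and down: "\<And>\<sigma> \<tau>. \<sigma> \<in> K \<Longrightarrow> \<tau> \<subseteq> \<sigma> \<Longrightarrow> \<tau> \<in> K"
    and sV: "\<And>\<sigma>. \<sigma> \<in> K \<Longrightarrow> \<sigma> \<subseteq> vertices K"
    using K by (auto simp: finite_simplicial_complex_def abstract_simplicial_complex_def vertices_def)
  define X where "X = geometric_realization K"
  define supp where "supp = (\<lambda>x::'v \<Rightarrow> real. {v. x v \<noteq> 0})"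
  have X: "supp x \<in> K" "\<And>v. 0 \<le> x v" "\<And>v. v \<notin> vertices K \<Longrightarrow> x v = 0" if "x \<in> X" for x
    using that sV by (auto simp: X_def geometric_realization_def supp_def vertices_def)
  define to_vec where "to_vec = (\<lambda>x. \<chi> k. (x (b k) :: real))"
  define of_vec where "of_vec = (\<lambda>z::real^'n. \<lambda>v. if v \<in> vertices K then z $ inv_into UNIV b v else 0)"
  define S where "S = to_vec ` X"
  have inv_b: "b (inv_into UNIV b v) = v" if "v \<in> vertices K" for v
    using b that by (metis bij_betw_imp_surj_on f_inv_into_f)
  have injb: "inj b" using b by (simp add: bij_betw_def)
  have of_to: "of_vec (to_vec x) = x" if "x \<in> X" for x
    using X(3)[OF that] by (auto simp: of_vec_def to_vec_def inv_b)
  have to_of: "to_vec (of_vec z) = z" for z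
    using b by (auto simp: of_vec_def to_vec_def vec_eq_iff injb inv_f_f bij_betw_def)
  have cont_to: "continuous_on A to_vec" for A
    unfolding to_vec_def
    by (intro continuous_on_vec_lambda continuous_on_subset[OF continuous_on_product_coordinates]) auto
  have cont_of: "continuous_on A (\<lambda>z. of_vec z v)" for A v
    unfolding of_vec_def by (cases "v \<in> vertices K") (auto intro!: continuous_intros)
  have homeo: "homeomorphism X S to_vec of_vec"
  proof (rule homeomorphismI)
    show "continuous_on S of_vec"
      by (rule continuous_on_coordinatewise_then_product) (rule cont_of)
    show "of_vec ` S \<subseteq> X" by (auto simp: S_def of_to)
  qed (auto simp: S_def of_to to_of cont_to)
  then have "homeomorphic_maps (top_of_set X) (top_of_set S) to_vec of_vec"
    by (auto simp: homeomorphic_maps_def homeomorphism_def)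
  then have "contractible S"
    using contr homeomorphic_space_contractibility[of "top_of_set X" "top_of_set S"]
    by (auto simp: X_def homeomorphic_space_def)
  then obtain a where hom: "homotopic_with_canon (\<lambda>x. True) S S id (\<lambda>x. a)"
    by (auto simp: contractible_def)
  \<comment> \<open>\<open>mk x l\<close> encodes the point over \<open>x\<close> with labelling \<open>l\<close>\<close>
  define mk where "mk = (\<lambda>x l. \<chi> k. (if snd (c k) = l (fst (c k)) then x (fst (c k)) else (0::real)))"
  define good where "good = (\<lambda>x l. (\<forall>v. l v \<in> F) \<and> (\<forall>u\<in>supp x. \<forall>w\<in>supp x. g u w (l u) = l w))"
  define C where "C = {(z, y). z \<in> S \<and> (\<exists>l. good (of_vec z) l \<and> y = mk (of_vec z) l)}"
  define crd where "crd = (\<lambda>y::real^'m. \<lambda>v i. y $ inv_into UNIV c (v, i))"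
  have inv_c: "c (inv_into UNIV c (v, i)) = (v, i)" if "v \<in> vertices K" "i \<in> F" for v i
    using c that by (metis SigmaI bij_betw_imp_surj_on f_inv_into_f)
  have crd_mk: "crd (mk x l) v i = (if i = l v then x v else 0)" if "v \<in> vertices K" "i \<in> F" for x l v i
    using inv_c[OF that] by (cases "i = l v") (auto simp: crd_def mk_def)
  have OX: "of_vec z \<in> X" if "z \<in> S" for z using that by (auto simp: S_def of_to)
  \<comment> \<open>over the open star \<open>U v\<close> the label \<open>i\<close> of \<open>v\<close> determines all other labels; this gives the sheets \<open>W v i\<close>\<close>
  define sheet where "sheet = (\<lambda>v i z. (z, mk (of_vec z) (\<lambda>w. g v w i)))"
  define W where "W = (\<lambda>v i. {zy \<in> C. crd (snd zy) v i > 0})"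
  define U where "U = (\<lambda>v. {z \<in> S. of_vec z v > 0})"
  have suppv: "v \<in> supp (of_vec z)" if "z \<in> U v" for v z
    using that by (auto simp: U_def supp_def)
  have good_sheet: "good (of_vec z) (\<lambda>w. g v w i)" if "z \<in> U v" "i \<in> F" for v i z
    using that suppv[OF that(1)] cocycle[OF X(1)[OF OX]] gF by (auto simp: good_def U_def)
  have Uvert: "v \<in> vertices K" if "z \<in> U v" for v z
    using that by (auto simp: U_def of_vec_def split: if_splits)
  have in_W: "zy \<in> W v i \<longleftrightarrow> fst zy \<in> U v \<and> zy = sheet v i (fst zy)"
    if v: "v \<in> vertices K" "i \<in> F" for v i zy
  proof
    assume "zy \<in> W v i"
    then obtain z l where zy: "zy = (z, mk (of_vec z) l)" and zS: "z \<in> S"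
      and good: "good (of_vec z) l" and pos: "crd (mk (of_vec z) l) v i > 0"
      by (auto simp: W_def C_def)
    then have il: "i = l v" and vpos: "of_vec z v > 0"
      using crd_mk[OF v] by (auto split: if_splits)
    have zU: "z \<in> U v" using zS vpos by (auto simp: U_def)
    have "mk (of_vec z) l = mk (of_vec z) (\<lambda>w. g v w i)"
      using good suppv[OF zU] unfolding il by (auto simp: mk_def vec_eq_iff good_def supp_def)
    then show "fst zy \<in> U v \<and> zy = sheet v i (fst zy)"
      using zU by (simp add: sheet_def zy)
  next
    assume *: "fst zy \<in> U v \<and> zy = sheet v i (fst zy)"
    obtain z y where zy: "zy = (z, y)" by (cases zy)
    with * have "z \<in> U v" and y: "y = mk (of_vec z) (\<lambda>w. g v w i)" by (auto simp: sheet_def)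
    then show "zy \<in> W v i"
      using good_sheet[of z v i] v crd_mk[OF v] refl
      by (auto simp: W_def zy C_def U_def)
  qed
  have cov: "covering_space C fst S"
  proof
    show "continuous_on C fst" by (intro continuous_intros)
    show "fst ` C = S"
    proof
      show "S \<subseteq> fst ` C"
      proof
        fix z assume z: "z \<in> S"
        have "(\<Sum>v | of_vec z v \<noteq> 0. of_vec z v) = 1"
          using OX[OF z] by (auto simp: X_def geometric_realization_def)
        then obtain v where "of_vec z v \<noteq> 0"
          by (metis (mono_tags, lifting) mem_Collect_eq sum.neutral zero_neq_one)
        then have "z \<in> U v" using z X(2)[OF OX[OF z], of v] by (auto simp: U_def)
        moreover obtain i where "i \<in> F" using F by blast
        ultimately have "sheet v i z \<in> W v i" using in_W Uvert by (auto simp: sheet_def)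
        then show "z \<in> fst ` C" by (force simp: W_def sheet_def)
      qed
    qed (auto simp: C_def)
    fix z assume z: "z \<in> S"
    have "(\<Sum>v | of_vec z v \<noteq> 0. of_vec z v) = 1"
      using OX[OF z] by (auto simp: X_def geometric_realization_def)
    then obtain v where "of_vec z v \<noteq> 0"
      by (metis (mono_tags, lifting) mem_Collect_eq sum.neutral zero_neq_one)
    then have zU: "z \<in> U v" using z X(2)[OF OX[OF z], of v] by (auto simp: U_def)
    have v: "v \<in> vertices K" using Uvert[OF zU] .
    have openU: "openin (top_of_set S) (U v)"
    proof -
      have "U v = S \<inter> (\<lambda>z. of_vec z v) -` {0<..}" by (auto simp: U_def)
      then show ?thesis using continuous_openin_preimage_gen[OF cont_of, of "{0<..}" S v] by simp
    qed
    show "\<exists>T. z \<in> T \<and> openin (top_of_set S) T \<and>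
           (\<exists>\<V>. \<Union>\<V> = C \<inter> fst -` T \<and> (\<forall>u\<in>\<V>. openin (top_of_set C) u) \<and>
              pairwise disjnt \<V> \<and> (\<forall>u\<in>\<V>. \<exists>q. homeomorphism u T fst q))"
    proof (intro exI[of _ "U v"] exI[of _ "W v ` F"] conjI zU openU ballI)
      show "\<Union> (W v ` F) = C \<inter> fst -` U v"
      proof (intro equalityI subsetI)
        fix zy assume "zy \<in> \<Union> (W v ` F)"
        then obtain i where "i \<in> F" "zy \<in> W v i" by auto
        then show "zy \<in> C \<inter> fst -` U v"
          using in_W[OF v, of i zy] by (simp add: W_def)
      next
        fix zy assume zy: "zy \<in> C \<inter> fst -` U v"
        then obtain l where l: "good (of_vec (fst zy)) l" "snd zy = mk (of_vec (fst zy)) l"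
          by (auto simp: C_def)
        have "l v \<in> F" using l by (simp add: good_def)
        moreover have "crd (snd zy) v (l v) > 0"
          using zy crd_mk[OF v \<open>l v \<in> F\<close>] l by (auto simp: U_def)
        ultimately show "zy \<in> \<Union> (W v ` F)" using zy by (auto simp: W_def)
      qed
      show "pairwise disjnt (W v ` F)"
      proof -
        have "i = j" if "zy \<in> W v i" "zy \<in> W v j" "i \<in> F" "j \<in> F" for i j zy
          using that crd_mk[OF v] by (auto simp: W_def C_def split: if_splits)
        then show ?thesis by (auto simp: pairwise_def disjnt_iff)
      qed
    next
      fix A assume "A \<in> W v ` F"
      then obtain i where i: "i \<in> F" and A: "A = W v i" by auto
      have "continuous_on C (\<lambda>zy. crd (snd zy) v i)"
        unfolding crd_def by (intro continuous_intros)
      moreover have "A = C \<inter> (\<lambda>zy. crd (snd zy) v i) -` {0<..}" by (auto simp: A W_def)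
      ultimately show "openin (top_of_set C) A"
        using continuous_openin_preimage_gen[of C "\<lambda>zy. crd (snd zy) v i" "{0<..}"] by simp
      show "\<exists>q. homeomorphism A (U v) fst q"
      proof (intro exI homeomorphismI)
        show "continuous_on A fst" by (intro continuous_intros)
        have "continuous_on (U v) (\<lambda>z. mk (of_vec z) (\<lambda>w. g v w i))"
          unfolding mk_def
        proof (rule continuous_on_vec_lambda)
          fix k
          show "continuous_on (U v)
              (\<lambda>z. if snd (c k) = g v (fst (c k)) i then of_vec z (fst (c k)) else 0)"
            by (cases "snd (c k) = g v (fst (c k)) i") (auto intro: cont_of)
        qed
        then show "continuous_on (U v) (sheet v i)"
          unfolding sheet_def by (intro continuous_intros)
        have fst_sheet: "fst (sheet v i z) = z" for z by (simp add: sheet_def)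
        show "sheet v i ` U v \<subseteq> A"
          unfolding A by (rule image_subsetI) (simp only: in_W[OF v i] fst_sheet simp_thms)
        show "fst ` A \<subseteq> U v"
          unfolding A by (rule image_subsetI) (simp only: in_W[OF v i])
        show "sheet v i (fst zy) = zy" if "zy \<in> A" for zy
          using that unfolding A in_W[OF v i] by simp
        show "fst (sheet v i z) = z" for z by (simp add: sheet_def)
      qed
    qed
  qed
  obtain s where s: "continuous_on S s" "s ` S \<subseteq> C" "\<And>z. z \<in> S \<Longrightarrow> fst (s z) = z"
    using covering_space_lift_inessential_function[OF cov hom] by auto
  define val where "val = (\<lambda>x v i. crd (snd (s (to_vec x))) v i)"
  have ex_l: "\<exists>l. good x l \<and> (\<forall>v\<in>vertices K. \<forall>i\<in>F. val x v i = (if i = l v then x v else 0))"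
    if x: "x \<in> X" for x
  proof -
    have "to_vec x \<in> S" using x by (simp add: S_def)
    then have "s (to_vec x) \<in> C" "fst (s (to_vec x)) = to_vec x" using s by auto
    then obtain l where "good x l" "snd (s (to_vec x)) = mk x l"
      using x by (auto simp: C_def of_to)
    then show ?thesis using crd_mk by (auto simp: val_def)
  qed
  define e where "e = (\<lambda>u v::'v. \<lambda>t::real. \<lambda>w. (if w = u then 1 - t else 0) + (if w = v then t else 0))"
  have eX: "e u v t \<in> X" if uv: "{u, v} \<in> K" and t: "0 \<le> t" "t \<le> 1" for u v t
  proof -
    have sub: "supp (e u v t) \<subseteq> {u, v}" by (auto simp: supp_def e_def split: if_splits)
    then have "supp (e u v t) \<in> K" using down uv by blast
    moreover have "(\<Sum>w\<in>supp (e u v t). e u v t w) = (\<Sum>w\<in>{u, v}. e u v t w)"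
      by (rule sum.mono_neutral_left) (use sub in \<open>auto simp: supp_def\<close>)
    moreover have "(\<Sum>w\<in>{u, v}. e u v t w) = 1"
      by (cases "u = v") (auto simp: e_def)
    ultimately show ?thesis using t by (auto simp: X_def geometric_realization_def supp_def e_def)
  qed
  have eV: "e v v 0 \<in> X" if "v \<in> vertices K" for v
  proof -
    from that obtain \<sigma> where "\<sigma> \<in> K" "v \<in> \<sigma>" by (auto simp: vertices_def)
    then have "{v, v} \<in> K" using down[of \<sigma> "{v, v}"] by auto
    then show ?thesis using eX[of v v 0] by simp
  qed
  have "\<exists>l. \<forall>v\<in>vertices K. l v \<in> F \<and> val (e v v 0) v (l v) = 1"
  proof (rule bchoice, rule ballI)
    fix v assume v: "v \<in> vertices K"
    obtain l where "good (e v v 0) l"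
      "\<forall>u\<in>vertices K. \<forall>i\<in>F. val (e v v 0) u i = (if i = l u then e v v 0 u else 0)"
      using ex_l[OF eV[OF v]] by blast
    then show "\<exists>i. i \<in> F \<and> val (e v v 0) v i = 1"
      using v by (intro exI[of _ "l v"]) (auto simp: good_def e_def)
  qed
  then obtain l where l: "\<And>v. v \<in> vertices K \<Longrightarrow> l v \<in> F"
      "\<And>v. v \<in> vertices K \<Longrightarrow> val (e v v 0) v (l v) = 1" by blast
  have "g u v (l u) = l v" if uv: "{u, v} \<in> K" for u v
  proof (cases "u = v")
    case True
    have "u \<in> vertices K" using sV[OF uv] by auto
    then show ?thesis using True l(1) by (simp add: refl)
  next
    case False
    have u: "u \<in> vertices K" and v: "v \<in> vertices K" using sV[OF uv] by auto
    have e0: "e u v 0 = e u u 0" and e1: "e u v 1 = e v v 0" using False by (auto simp: e_def)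
    have cont: "continuous_on {0..1} (\<lambda>t. val (e u v t) w i)" for w i
    proof -
      have "continuous_on {0..1} (\<lambda>t. to_vec (e u v t))"
        unfolding to_vec_def
      proof (rule continuous_on_vec_lambda)
        fix k show "continuous_on {0..1} (\<lambda>t. e u v t (b k))"
          unfolding e_def by (cases "b k = u"; cases "b k = v") (auto intro!: continuous_intros)
      qed
      moreover have "(\<lambda>t. to_vec (e u v t)) ` {0..1} \<subseteq> S"
        using eX[OF uv] by (auto simp: S_def)
      ultimately have "continuous_on {0..1} (\<lambda>t. s (to_vec (e u v t)))"
        using continuous_on_compose2[OF s(1)] by blast
      then show ?thesis unfolding val_def crd_def by (intro continuous_intros)
    qed
    have lab: "\<exists>l'. good (e u v t) l' \<and> (\<forall>w\<in>vertices K. \<forall>i\<in>F.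
        val (e u v t) w i = (if i = l' w then e u v t w else 0))" if "0 \<le> t" "t \<le> 1" for t
      using ex_l[OF eX[OF uv that]] .
    \<comment> \<open>\<open>q\<close> is 0 or 1 according to whether the section has label \<open>l u\<close> at \<open>u\<close>; hence it is constant on the open star\<close>
    define q where "q = (\<lambda>t. val (e u v t) u (l u) / (1 - t))"
    have contq: "continuous_on {0..<1} q"
      unfolding q_def by (intro continuous_intros continuous_on_subset[OF cont]) auto
    have q01: "q t \<in> {0, 1}" if "t \<in> {0..<1}" for t
    proof -
      have "0 \<le> t" "t \<le> 1" using that by auto
      from lab[OF this] obtain l'
        where "\<forall>w\<in>vertices K. \<forall>i\<in>F. val (e u v t) w i = (if i = l' w then e u v t w else 0)"
        by blast
      then show ?thesis using u l(1)[OF u] that False by (auto simp: q_def e_def)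
    qed
    have "q ` {0..<1} \<subseteq> {0, 1}" using q01 by blast
    then have "finite (q ` {0..<1})" by (rule finite_subset) simp
    then have "q constant_on {0..<1}"
      using contq by (intro continuous_finite_range_constant) auto
    then have "q t = q 0" if "t \<in> {0..<1}" for t using that by (auto simp: constant_on_def)
    moreover have "q 0 = 1" using l(2)[OF u] e0 by (simp add: q_def)
    ultimately have q1: "q t = 1" if "t \<in> {0..<1}" for t using that by simp
    define j where "j = g u v (l u)"
    have jF: "j \<in> F" using gF l(1)[OF u] by (simp add: j_def)
    have vt: "val (e u v t) v j = t" if t: "0 < t" "t < 1" for t
    proof -
      have "0 \<le> t" "t \<le> 1" using t by auto
      from lab[OF this] obtain l' where l': "good (e u v t) l'"
        "\<And>w i. w \<in> vertices K \<Longrightarrow> i \<in> F \<Longrightarrow> val (e u v t) w i = (if i = l' w then e u v t w else 0)"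
        by blast
      have "val (e u v t) u (l u) \<noteq> 0" using q1[of t] t by (auto simp: q_def)
      then have "l u = l' u" using l'(2)[OF u l(1)[OF u]] by (auto split: if_splits)
      moreover have "u \<in> supp (e u v t)" "v \<in> supp (e u v t)"
        using t False by (auto simp: supp_def e_def)
      ultimately have "j = l' v" using l'(1) by (auto simp: good_def j_def)
      then show ?thesis using l'(2)[OF v jF] False by (simp add: e_def)
    qed
    \<comment> \<open>at \<open>v\<close> itself the label of \<open>u\<close> is lost, but the coordinate at \<open>(v, j)\<close> tends to 1\<close>
    have lim: "((\<lambda>t. val (e u v t) v j) \<longlongrightarrow> val (e u v 1) v j) (at 1 within {0..1})"
      using cont[of v j] by (simp add: continuous_on_def)
    have "val (e u v 1) v j = 1"
    proof (rule tendsto_unique)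
      show "((\<lambda>t. val (e u v t) v j) \<longlongrightarrow> val (e u v 1) v j) (at 1 within {0<..<1})"
        using lim by (rule tendsto_within_subset) auto
      have "((\<lambda>t::real. t) \<longlongrightarrow> 1) (at 1 within {0<..<1})" by (rule tendsto_ident_at)
      moreover have "\<forall>\<^sub>F t in at 1 within {0<..<1}. t = val (e u v t) v j"
        by (auto simp: eventually_at_filter vt)
      ultimately show "((\<lambda>t. val (e u v t) v j) \<longlongrightarrow> 1) (at 1 within {0<..<1})"
        by (rule Lim_transform_eventually)
      show "at (1::real) within {0<..<1} \<noteq> bot"
        by (simp add: at_within_eq_bot_iff)
    qed
    moreover obtain l' where "\<forall>i\<in>F. val (e v v 0) v i = (if i = l' v then e v v 0 v else 0)"
      using ex_l[OF eV[OF v]] v by blast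
    ultimately show ?thesis
      using jF l[OF v] by (auto simp: e1 j_def split: if_splits)
  qed
  then show False using nosec[of l] l(1) by blast
qed

section \<open>Checking separation by hyperplanes\<close>

type_synonym int4 = "int \<times> int \<times> int \<times> int"

fun dot4 :: "int4 \<Rightarrow> int4 \<Rightarrow> int" where
  "dot4 (a, b, c, d) (x, y, z, w) = a * x + b * y + c * z + d * w"

text \<open>
  Disjointness of vertex sets is decided thousands of times by rewriting; for bit masks it
  is a single bitwise conjunction, much cheaper than comparing lists.
\<close>

fun mask_of :: "nat list \<Rightarrow> int" where
  "mask_of [] = 0"
| "mask_of (v # vs) = set_bit v (mask_of vs)"

text \<open>
  A pair \<open>(a, th)\<close> stands for the hyperplane on which the functional \<open>a\<close> has the value \<open>th + 1/2\<close>. It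
  contains no lattice point, so it splits the vertices into two sets without remainder.
\<close>

definition side_masks :: "(nat \<times> int4) list \<Rightarrow> (int4 \<times> int) list \<Rightarrow> (int \<times> int) list" where
  "side_masks ps hs = map (\<lambda>(a, th).
     (mask_of (map fst (filter (\<lambda>(v, x). th < dot4 a x) ps)),
      mask_of (map fst (filter (\<lambda>(v, x). dot4 a x \<le> th) ps)))) hs"

text \<open>
  A simplex disjoint from any one of these sets lies on the other side of some hyperplane than \<open>m\<close>.
\<close>

definition far_sides :: "(int \<times> int) list \<Rightarrow> int \<Rightarrow> int list" where
  "far_sides S m = concat (map (\<lambda>(p, n).
     (if and m n = 0 then [p] else []) @ (if and m p = 0 then [n] else [])) S)"

definition separated_from :: "int list \<Rightarrow> int \<Rightarrow> int list \<Rightarrow> bool" where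
  "separated_from R m ms \<longleftrightarrow>
     list_all (\<lambda>k. and m k \<noteq> 0 \<or> list_ex (\<lambda>r. and k r = 0) R) ms"

fun all_separated :: "(int \<times> int) list \<Rightarrow> int list \<Rightarrow> bool" where
  "all_separated S [] \<longleftrightarrow> True"
| "all_separated S (m # ms) \<longleftrightarrow> separated_from (far_sides S m) m ms \<and> all_separated S ms"

lemma bit_mask_of: "bit (mask_of l) v \<longleftrightarrow> v \<in> set l"
  by (induction l) (auto simp: bit_set_bit_iff)

lemma and_mask_of_eq_0_iff: "and (mask_of l) (mask_of m) = 0 \<longleftrightarrow> set l \<inter> set m = {}"
  by (auto simp: bit_eq_iff bit_and_iff bit_mask_of)

lemma all_separated_pair:
  assumes "all_separated S ms" "m \<in> set ms" "k \<in> set ms" "m \<noteq> k" "and m k = 0"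
  shows "\<exists>(p, n)\<in>set S. and m n = 0 \<and> and k p = 0 \<or> and m p = 0 \<and> and k n = 0"
  using assms
proof (induction ms)
  case (Cons a ms)
  have *: "\<exists>(p, n)\<in>set S. and a n = 0 \<and> and k p = 0 \<or> and a p = 0 \<and> and k n = 0"
    if "k \<in> set ms" "and a k = 0" for k
  proof -
    from that Cons.prems(1) obtain r where r: "r \<in> set (far_sides S a)" "and k r = 0"
      by (auto simp: separated_from_def list_all_iff list_ex_iff)
    then obtain p n where "(p, n) \<in> set S" "and a n = 0 \<and> r = p \<or> and a p = 0 \<and> r = n"
      unfolding far_sides_def by (auto split: if_splits)
    with r show ?thesis by blast
  qed
  consider "m = a" "k \<in> set ms" | "k = a" "m \<in> set ms" | "m \<in> set ms" "k \<in> set ms"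
    using Cons.prems by auto
  then show ?case
  proof cases
    case 1
    then show ?thesis using *[of k] Cons.prems by simp
  next
    case 2
    then obtain p n where "(p, n) \<in> set S"
      "and a n = 0 \<and> and m p = 0 \<or> and a p = 0 \<and> and m n = 0"
      using *[of m] Cons.prems by (auto simp: and.commute)
    then show ?thesis using 2 by blast
  next
    case 3
    then show ?thesis using Cons by simp
  qed
qed simp

definition point :: "int4 \<Rightarrow> real ^ 4" where
  "point = (\<lambda>(x, y, z, w). vector [of_int x, of_int y, of_int z, of_int w])"

lemma point_inner: "point a \<bullet> point x = of_int (dot4 a x)"
  by (cases a; cases x) (simp add: point_def inner_vec_def sum_4 vector_def)

lemma point_Ints: "point x $ j \<in> \<int>"
  using exhaust_4[of j] by (cases x) (auto simp: point_def vector_def)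

lemma polyhedral_realization_if_all_separated:
  assumes K: "finite_simplicial_complex (set ` set F)"
    and ms: "all_separated (side_masks (map (\<lambda>v. (v, pos v)) vs) hs) (map mask_of (filter (\<lambda>l. l \<noteq> []) F))"
    and vs: "\<And>l. l \<in> set F \<Longrightarrow> set l \<subseteq> set vs"
  shows "polyhedral_realization (set ` set F) (\<lambda>v. point (pos v))"
proof (rule polyhedral_realization_if_separated[OF K])
  fix \<sigma> \<tau> assume "\<sigma> \<in> set ` set F" "\<tau> \<in> set ` set F" and ne: "\<sigma> \<noteq> {}" "\<tau> \<noteq> {}" and dis: "\<sigma> \<inter> \<tau> = {}"
  then obtain l m where l: "l \<in> set F" "\<sigma> = set l" and m: "m \<in> set F" "\<tau> = set m" by auto
  let ?S = "side_masks (map (\<lambda>v. (v, pos v)) vs) hs"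
  have "and (mask_of l) (mask_of m) = 0" using dis l m by (simp add: and_mask_of_eq_0_iff)
  moreover have "mask_of l \<noteq> mask_of m"
  proof
    assume "mask_of l = mask_of m"
    then have "\<sigma> = \<tau>" unfolding l m using bit_mask_of[of l] bit_mask_of[of m] by auto
    with dis ne show False by simp
  qed
  ultimately obtain p n where pn: "(p, n) \<in> set ?S"
    and sep: "and (mask_of l) n = 0 \<and> and (mask_of m) p = 0
      \<or> and (mask_of l) p = 0 \<and> and (mask_of m) n = 0"
    using all_separated_pair[OF ms, of "mask_of l" "mask_of m"] l m ne by auto
  from pn obtain a th where p: "p = mask_of (filter (\<lambda>v. th < dot4 a (pos v)) vs)"
    and n: "n = mask_of (filter (\<lambda>v. dot4 a (pos v) \<le> th) vs)"
    by (auto simp: side_masks_def filter_map o_def)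
  have plus: "\<forall>v\<in>set k. point a \<bullet> point (pos v) > of_int th + 1/2"
    if "k \<in> set F" "and (mask_of k) n = 0" for k
  proof
    fix v assume "v \<in> set k"
    then have "th < dot4 a (pos v)"
      using that vs[OF that(1)] by (force simp: n and_mask_of_eq_0_iff)
    then have "of_int th + 1 \<le> (of_int (dot4 a (pos v)) :: real)" by linarith
    then show "point a \<bullet> point (pos v) > of_int th + 1/2" by (simp add: point_inner)
  qed
  have minus: "\<forall>v\<in>set k. point a \<bullet> point (pos v) < of_int th + 1/2"
    if "k \<in> set F" "and (mask_of k) p = 0" for k
  proof
    fix v assume "v \<in> set k"
    then have "dot4 a (pos v) \<le> th"
      using that vs[OF that(1)] by (force simp: p and_mask_of_eq_0_iff)
    then have "(of_int (dot4 a (pos v)) :: real) \<le> of_int th" by linarith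
    then show "point a \<bullet> point (pos v) < of_int th + 1/2" by (simp add: point_inner)
  qed
  show "\<exists>a b. (\<forall>v\<in>\<sigma>. a \<bullet> point (pos v) > b) \<and> (\<forall>v\<in>\<tau>. a \<bullet> point (pos v) < b)"
    using sep
  proof
    assume "and (mask_of l) n = 0 \<and> and (mask_of m) p = 0"
    then show ?thesis using plus minus l m by metis
  next
    assume "and (mask_of l) p = 0 \<and> and (mask_of m) n = 0"
    then have "(\<forall>v\<in>\<sigma>. - point a \<bullet> point (pos v) > - (of_int th + 1/2)) \<and>
        (\<forall>v\<in>\<tau>. - point a \<bullet> point (pos v) < - (of_int th + 1/2))"
      using plus[of m] minus[of l] l m by auto
    then show ?thesis by blast
  qed
qed

section \<open>Checking chain contractions\<close>

type_synonym chain_list = "(int \<times> nat list) list"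

text \<open>
  The sorted list \<open>x # xs\<close> is the cone over \<open>xs\<close> with apex \<open>x\<close>, and the boundary of a cone is its base minus
  the cone over the boundary of the base.
\<close>

fun list_boundary :: "nat list \<Rightarrow> chain_list" where
  "list_boundary [] = []"
| "list_boundary (x # xs) = (1, xs) # map (\<lambda>(c, ys). (- c, x # ys)) (list_boundary xs)"

definition scale_list :: "int \<Rightarrow> chain_list \<Rightarrow> chain_list" where
  "scale_list k = map (\<lambda>(c, l). (k * c, l))"

definition extend_list :: "(nat list \<Rightarrow> chain_list) \<Rightarrow> chain_list \<Rightarrow> chain_list" where
  "extend_list f xs = concat (map (\<lambda>(c, l). scale_list c (f l)) xs)"

fun add_term :: "int \<Rightarrow> nat list \<Rightarrow> chain_list \<Rightarrow> chain_list" where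
  "add_term c l [] = [(c, l)]"
| "add_term c l ((d, m) # xs) =
     (if l = m then (if c + d = 0 then xs else (c + d, m) # xs) else (d, m) # add_term c l xs)"

text \<open>
  Collecting equal simplices and dropping zero coefficients leaves a list with a single entry exactly if
  the chain is that one term, so equations of the form \<open>c = \<sigma>\<close> become syntactic.
\<close>

definition normal_list :: "chain_list \<Rightarrow> chain_list" where
  "normal_list xs = foldr (\<lambda>(c, l). add_term c l) xs []"

definition chain_of :: "chain_list \<Rightarrow> (nat set \<Rightarrow>\<^sub>0 int)" where
  "chain_of xs = (\<Sum>(c, l)\<leftarrow>xs. frag_cmul c (frag_of (set l)))"

lemma chain_of_simps [simp]:
  "chain_of [] = 0"
  "chain_of ((c, l) # xs) = frag_cmul c (frag_of (set l)) + chain_of xs"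
  "chain_of (xs @ ys) = chain_of xs + chain_of ys"
  by (simp_all add: chain_of_def)

lemma chain_of_scale [simp]: "chain_of (scale_list k xs) = frag_cmul k (chain_of xs)"
  by (induction xs) (auto simp: scale_list_def frag_cmul_distrib2)

lemma chain_of_add_term: "chain_of (add_term c l xs) = frag_cmul c (frag_of (set l)) + chain_of xs"
proof (induction c l xs rule: add_term.induct)
  case (2 c l d m xs)
  let ?l = "frag_of (set l)"
  have "frag_cmul c ?l + (frag_cmul d ?l + chain_of xs) = frag_cmul (c + d) ?l + chain_of xs"
    by (simp only: frag_cmul_distrib add.assoc)
  with 2 show ?case
    by (cases "l = m"; cases "c + d = 0") (simp_all add: add.left_commute)
qed simp

lemma chain_of_normal: "chain_of (normal_list xs) = chain_of xs"
  by (induction xs) (auto simp: normal_list_def chain_of_add_term)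

lemma chain_of_extend:
  assumes "\<And>c l. (c, l) \<in> set xs \<Longrightarrow> chain_of (f l) = g (set l)"
  shows "chain_of (extend_list f xs) = frag_extend g (chain_of xs)"
  using assms
proof (induction xs)
  case (Cons x xs)
  obtain c l where x: "x = (c, l)" by (cases x)
  have "chain_of (f l) = g (set l)" by (rule Cons.prems[of c]) (simp add: x)
  moreover have "chain_of (extend_list f xs) = frag_extend g (chain_of xs)"
    by (rule Cons.IH) (use Cons.prems in auto)
  ultimately show ?case
    by (simp add: x extend_list_def frag_extend_add frag_extend_cmul)
qed (simp add: extend_list_def)

lemma chain_of_list_boundary:
  "sorted_wrt (<) l \<Longrightarrow> chain_of (list_boundary l) = simplex_boundary (set l)"
proof (induction l)
  case (Cons x xs)
  have xs: "x \<notin> set xs" "\<And>y. y \<in> set xs \<Longrightarrow> x < y" using Cons.prems by auto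
  have cone: "chain_of (map (\<lambda>(c, ys). (- c, x # ys)) ys) = - frag_extend (\<lambda>\<sigma>. frag_of (insert x \<sigma>)) (chain_of ys)" for ys
    by (induction ys) (auto simp: frag_extend_add frag_extend_cmul)
  have "simplex_boundary (set (x # xs)) = frag_of (set xs) +
      (\<Sum>v\<in>set xs. frag_cmul ((-1) ^ card {u \<in> insert x (set xs). u < v}) (frag_of (insert x (set xs) - {v})))"
  proof -
    have "{u \<in> insert x (set xs). u < x} = {}" by (auto dest!: xs(2))
    then show ?thesis
      by (simp only: simplex_boundary_def list.set(2) sum.insert[OF finite_set xs(1)] card.empty
          power_0 frag_cmul_one Diff_insert_absorb[OF xs(1)])
  qed
  also have "(\<Sum>v\<in>set xs. frag_cmul ((-1) ^ card {u \<in> insert x (set xs). u < v}) (frag_of (insert x (set xs) - {v})))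
     = (\<Sum>v\<in>set xs. - frag_cmul ((-1) ^ card {u \<in> set xs. u < v}) (frag_of (insert x (set xs - {v}))))"
  proof (rule sum.cong)
    fix v assume v: "v \<in> set xs"
    have "{u \<in> insert x (set xs). u < v} = insert x {u \<in> set xs. u < v}"
      using xs(2)[OF v] by auto
    then have "card {u \<in> insert x (set xs). u < v} = Suc (card {u \<in> set xs. u < v})" using xs by simp
    moreover have "insert x (set xs) - {v} = insert x (set xs - {v})" using xs v by auto
    ultimately show "frag_cmul ((-1) ^ card {u \<in> insert x (set xs). u < v}) (frag_of (insert x (set xs) - {v}))
       = - frag_cmul ((-1) ^ card {u \<in> set xs. u < v}) (frag_of (insert x (set xs - {v})))" by simp
  qed simp
  also have "\<dots> = - frag_extend (\<lambda>\<sigma>. frag_of (insert x \<sigma>)) (simplex_boundary (set xs))"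
    by (simp only: sum_negf) (simp add: simplex_boundary_def frag_extend_sum frag_extend_cmul)
  finally show ?case using Cons by (simp add: cone)
qed (simp add: simplex_boundary_def)

definition contracts :: "(nat list \<Rightarrow> chain_list) \<Rightarrow> nat list \<Rightarrow> bool" where
  "contracts h l \<longleftrightarrow>
     normal_list (extend_list list_boundary (h l) @ extend_list h (list_boundary l)) = [(1, l)]"

definition raises_degree :: "nat list list \<Rightarrow> (nat list \<Rightarrow> chain_list) \<Rightarrow> nat list \<Rightarrow> bool" where
  "raises_degree F h l \<longleftrightarrow> list_all (\<lambda>(c, m). length m = Suc (length l) \<and> m \<in> set F) (h l)"

lemma sorted_list_boundary:
  "sorted_wrt (<) l \<Longrightarrow> (c, m) \<in> set (list_boundary l) \<Longrightarrow> sorted_wrt (<) m \<and> set m \<subseteq> set l"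
proof (induction l arbitrary: c m)
  case (Cons x xs)
  consider "m = xs" | c' ys where "(c', ys) \<in> set (list_boundary xs)" "m = x # ys"
    using Cons.prems(2) by auto
  then show ?case
  proof cases
    case 2
    then show ?thesis using Cons.IH[OF _ 2(1)] Cons.prems(1) by auto
  qed (use Cons.prems(1) in auto)
qed simp

lemma keys_chain_of: "Poly_Mapping.keys (chain_of xs) \<subseteq> (\<lambda>(c, l). set l) ` set xs"
proof (induction xs)
  case (Cons x xs)
  obtain c l where x: "x = (c, l)" by (cases x)
  have "Poly_Mapping.keys (chain_of (x # xs))
      \<subseteq> Poly_Mapping.keys (frag_cmul c (frag_of (set l))) \<union> Poly_Mapping.keys (chain_of xs)"
    unfolding x chain_of_simps by (rule Poly_Mapping.keys_add)
  also have "\<dots> \<subseteq> insert (set l) ((\<lambda>(c, l). set l) ` set xs)"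
    using Cons by (auto simp: image_iff)
  finally show ?case by (simp add: x)
qed simp

lemma Z_acyclic_if_contracts:
  assumes K: "abstract_simplicial_complex (set ` set F)"
    and sorted: "\<And>l. l \<in> set F \<Longrightarrow> sorted_wrt (<) l"
    and deg: "\<And>l. l \<in> set F \<Longrightarrow> raises_degree F h l"
    and contr: "\<And>l. l \<in> set F \<Longrightarrow> contracts h l"
  shows "Z_acyclic (set ` set F)"
proof (rule Z_acyclic_if_chain_contraction[OF K])
  define H where "H = (\<lambda>\<sigma>::nat set. chain_of (h (sorted_list_of_set \<sigma>)))"
  have H: "H (set l) = chain_of (h l)" if "sorted_wrt (<) l" for l
    using that by (simp add: H_def strict_sorted_iff sorted_list_of_set.idem_if_sorted_distinct)
  have card: "card (set l) = length l" if "sorted_wrt (<) l" for l :: "nat list"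
    using that by (simp add: strict_sorted_iff distinct_card)
  fix \<sigma> assume "\<sigma> \<in> set ` set F"
  then obtain l where l: "l \<in> set F" and \<sigma>: "\<sigma> = set l" by auto
  have deg': "m \<in> set F \<and> length m = Suc (length l)" if "(c, m) \<in> set (h l)" for c m
    using deg[OF l] that by (auto simp: raises_degree_def list_all_iff)
  show "Poly_Mapping.keys (H \<sigma>) \<subseteq> {\<tau> \<in> set ` set F. simplex_dim \<tau> = simplex_dim \<sigma> + 1}"
  proof
    fix \<tau> assume "\<tau> \<in> Poly_Mapping.keys (H \<sigma>)"
    then obtain c m where m: "(c, m) \<in> set (h l)" "\<tau> = set m"
      using keys_chain_of[of "h l"] H[OF sorted[OF l]] by (auto simp: \<sigma>)
    then show "\<tau> \<in> {\<tau> \<in> set ` set F. simplex_dim \<tau> = simplex_dim \<sigma> + 1}"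
      using deg'[OF m(1)] card sorted l by (auto simp: simplex_dim_def \<sigma>)
  qed
  have "frag_of \<sigma> = chain_of [(1, l)]" by (simp add: \<sigma>)
  also have "\<dots> = chain_of (extend_list list_boundary (h l)) + chain_of (extend_list h (list_boundary l))"
    using contr[OF l] chain_of_normal by (metis contracts_def chain_of_simps(3))
  also have "chain_of (extend_list list_boundary (h l)) = simplicial_boundary (H \<sigma>)"
    unfolding simplicial_boundary_def \<sigma> H[OF sorted[OF l]]
    by (rule chain_of_extend) (use deg' sorted chain_of_list_boundary in blast)
  also have "chain_of (extend_list h (list_boundary l)) = frag_extend H (simplex_boundary \<sigma>)"
    unfolding \<sigma> chain_of_list_boundary[OF sorted[OF l], symmetric]
    by (rule chain_of_extend) (use sorted_list_boundary[OF sorted[OF l]] H in metis)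
  finally show "simplicial_boundary (H \<sigma>) + frag_extend H (simplex_boundary \<sigma>) = frag_of \<sigma>"
    by simp
qed

section \<open>The complex and its certificates\<close>

text \<open>
  The 33 triangles on the vertices \<open>0, \<dots>, 9\<close> triangulate a space homotopy equivalent to the presentation
  complex of \<open>\<langle>s, t | s\<^sup>4 = t s t, t\<^sup>2 = s t s\<rangle>\<close>, which presents the binary icosahedral group. They arise
  from an embedded presentation complex in \<open>\<real>\<^sup>4\<close>, namely a wedge of two circles in \<open>\<real>\<^sup>3\<close> with one disc
  in the upper and one in the lower half space, by elementary collapses, expansions and edge contractions
  that keep the linear embedding.
\<close>

definition triangles :: "nat list list" where
  "triangles = [
    [0,1,3], [0,1,4], [0,2,4], [0,2,9], [0,3,5], [0,4,6], [0,4,8], [0,5,7], [0,5,9], [0,6,9],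
    [0,7,8], [1,2,5], [1,2,9], [1,3,6], [1,3,8], [1,4,5], [1,5,7], [1,6,7], [1,8,9], [2,3,4],
    [2,3,5], [2,3,8], [2,5,6], [2,6,7], [2,7,8], [2,7,9], [3,4,9], [3,5,7], [3,6,9], [3,7,9],
    [4,5,6], [4,5,9], [4,8,9]]"

definition core_edges :: "nat list list" where
  "core_edges = [
    [0,1], [0,2], [0,3], [0,4], [0,5], [0,6], [0,7], [0,8], [0,9], [1,2], [1,3], [1,4], [1,5],
    [1,6], [1,7], [1,8], [1,9], [2,3], [2,4], [2,5], [2,6], [2,7], [2,8], [2,9], [3,4], [3,5],
    [3,6], [3,7], [3,8], [3,9], [4,5], [4,6], [4,8], [4,9], [5,6], [5,7], [5,9], [6,7], [6,9],
    [7,8], [7,9], [8,9]]"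

text \<open>
  A path leaving vertex \<open>9\<close> raises the number of vertices to 23 without changing the homotopy type.
\<close>

definition tail_edges :: "nat list list" where
  "tail_edges = map (\<lambda>v. [v, v + 1]) [9..<22]"

definition facets :: "nat list list" where
  "facets = triangles @ tail_edges"

definition nonempty_faces :: "nat list list" where
  "nonempty_faces = map (\<lambda>v. [v]) [0..<23] @ core_edges @ tail_edges @ triangles"

definition faces :: "nat list list" where
  "faces = [] # nonempty_faces"

definition example_complex :: "nat set set" where
  "example_complex = set ` set faces"

text \<open>
  Vertex \<open>0\<close> is adjacent to all other vertices among \<open>0, \<dots>, 9\<close>, so the edges at \<open>0\<close> form a spanning tree
  and every other edge \<open>{u, v}\<close> closes up to a triangle of edges \<open>0, u, v\<close>. The square integer matrix that
  expresses the boundaries of the 33 triangles through the 33 edges away from \<open>0\<close> is unimodular. The rows of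
  its inverse, listed here, give the chain of triangles that fills each of these closed edge paths.
\<close>

definition fillings :: "(nat list \<times> int list) list" where
  "fillings = [
    ([1,2],[1,0,-1,0,1,0,-1,1,0,0,1,0,1,0,-1,0,0,0,-1,-1,0,1,0,0,-1,1,1,-1,0,-1,0,0,1]),
    ([1,3],[1,0,0,0,0,0,0,0,0,0,0,0,0,0,0,0,0,0,0,0,0,0,0,0,0,0,0,0,0,0,0,0,0]),
    ([1,4],[0,1,0,0,0,0,0,0,0,0,0,0,0,0,0,0,0,0,0,0,0,0,0,0,0,0,0,0,0,0,0,0,0]),
    ([1,5],[2,-1,-1,1,2,-1,-1,1,0,-1,1,-1,1,-1,-1,1,1,-1,-1,-1,0,1,1,1,-1,2,1,-2,1,-2,-1,0,1]),
    ([1,6],[2,-1,0,0,2,0,-1,1,1,-1,1,-1,1,-1,-1,1,0,0,-1,0,-1,1,0,0,-1,1,0,-1,1,-1,0,-1,1]),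
    ([1,7],[2,-1,-1,1,2,-1,-1,2,0,-1,1,-1,1,-1,-1,1,0,-1,-1,-1,0,1,1,1,-1,2,1,-2,1,-2,-1,0,1]),
    ([1,8],[-1,2,0,0,-1,1,1,0,-1,1,0,1,-1,1,0,-2,-1,1,1,0,0,0,-1,-1,0,-1,0,1,-1,1,1,1,-1]),
    ([1,9],[1,0,-1,1,1,0,-1,1,0,0,1,0,0,0,-1,0,0,0,-1,-1,0,1,0,0,-1,1,1,-1,0,-1,0,0,1]),
    ([2,3],[1,-1,0,1,0,-1,0,0,0,-1,0,0,0,-1,0,1,1,-1,0,0,1,0,1,1,0,1,0,-1,1,-1,-1,0,0]),
    ([2,4],[0,0,1,0,0,0,0,0,0,0,0,0,0,0,0,0,0,0,0,0,0,0,0,0,0,0,0,0,0,0,0,0,0]),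
    ([2,5],[1,-1,0,1,1,-1,0,0,0,-1,0,0,0,-1,0,1,1,-1,0,0,0,0,1,1,0,1,0,-1,1,-1,-1,0,0]),
    ([2,6],[-1,1,1,0,-1,1,1,-1,0,0,-1,1,-1,0,1,-1,0,0,1,1,0,-1,-1,0,1,-1,-1,1,0,1,1,0,-1]),
    ([2,7],[-1,1,0,1,-1,0,1,0,-1,0,-1,1,-1,0,1,-1,0,0,1,0,1,-1,0,0,1,0,0,0,0,0,0,1,-1]),
    ([2,8],[-1,1,0,1,-1,0,1,0,-1,0,0,1,-1,0,1,-1,0,0,1,0,1,-1,0,0,0,0,0,0,0,0,0,1,-1]),
    ([2,9],[0,0,0,1,0,0,0,0,0,0,0,0,0,0,0,0,0,0,0,0,0,0,0,0,0,0,0,0,0,0,0,0,0]),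
    ([3,4],[-1,1,1,-1,0,1,0,0,0,1,0,0,0,1,0,-1,-1,1,0,1,-1,0,-1,-1,0,-1,0,1,-1,1,1,0,0]),
    ([3,5],[0,0,0,0,1,0,0,0,0,0,0,0,0,0,0,0,0,0,0,0,0,0,0,0,0,0,0,0,0,0,0,0,0]),
    ([3,6],[1,-1,0,0,2,0,-1,1,1,-1,1,-1,1,0,-1,1,0,0,-1,0,-1,1,0,0,-1,1,0,-1,1,-1,0,-1,1]),
    ([3,7],[0,0,0,0,1,0,0,1,0,0,0,0,0,0,0,0,0,0,0,0,0,0,0,0,0,0,0,-1,0,0,0,0,0]),
    ([3,8],[-2,2,0,0,-1,1,1,0,-1,1,0,1,-1,1,1,-2,-1,1,1,0,0,0,-1,-1,0,-1,0,1,-1,1,1,1,-1]),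
    ([3,9],[1,-1,0,0,2,0,-1,1,1,0,1,-1,1,0,-1,1,0,0,-1,0,-1,1,0,0,-1,1,0,-1,0,-1,0,-1,1]),
    ([4,5],[2,-2,-1,1,2,-1,-1,1,0,-1,1,-1,1,-1,-1,2,1,-1,-1,-1,0,1,1,1,-1,2,1,-2,1,-2,-1,0,1]),
    ([4,6],[0,0,0,0,0,1,0,0,0,0,0,0,0,0,0,0,0,0,0,0,0,0,0,0,0,0,0,0,0,0,0,0,0]),
    ([4,8],[0,0,0,0,0,0,1,0,0,0,0,0,0,0,0,0,0,0,0,0,0,0,0,0,0,0,0,0,0,0,0,0,0]),
    ([4,9],[2,-2,-1,1,2,-1,-1,1,1,-1,1,-1,1,-1,-1,2,1,-1,-1,-1,0,1,1,1,-1,2,1,-2,1,-2,-1,-1,1]),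
    ([5,6],[-2,2,1,-1,-2,2,1,-1,0,1,-1,1,-1,1,1,-2,-1,1,1,1,0,-1,-1,-1,1,-2,-1,2,-1,2,2,0,-1]),
    ([5,7],[0,0,0,0,0,0,0,1,0,0,0,0,0,0,0,0,0,0,0,0,0,0,0,0,0,0,0,0,0,0,0,0,0]),
    ([5,9],[0,0,0,0,0,0,0,0,1,0,0,0,0,0,0,0,0,0,0,0,0,0,0,0,0,0,0,0,0,0,0,0,0]),
    ([6,7],[0,0,-1,1,0,-1,0,1,-1,0,0,0,0,0,0,0,0,0,0,-1,1,0,1,1,0,1,1,-1,0,-1,-1,1,0]),
    ([6,9],[0,0,0,0,0,0,0,0,0,1,0,0,0,0,0,0,0,0,0,0,0,0,0,0,0,0,0,0,0,0,0,0,0]),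
    ([7,8],[0,0,0,0,0,0,0,0,0,0,1,0,0,0,0,0,0,0,0,0,0,0,0,0,0,0,0,0,0,0,0,0,0]),
    ([7,9],[1,-1,0,0,1,0,-1,0,1,0,1,-1,1,0,-1,1,0,0,-1,0,-1,1,0,0,-1,1,0,0,0,0,0,-1,1]),
    ([8,9],[2,-2,-1,1,2,-1,-2,1,1,-1,1,-1,1,-1,-1,2,1,-1,-1,-1,0,1,1,1,-1,2,1,-2,1,-2,-1,-1,2])]"

text \<open>
  A vertex goes to a path from \<open>0\<close>, an edge to the filling of the cycle that it closes with these paths;
  that cycle is trivial for the edges of the spanning tree and of the path attached at \<open>9\<close>. Triangles can be sent to
  zero since the matrix of fillings is also a left inverse, so that \<open>h\<partial> = id\<close> holds on them.
\<close>

definition contraction :: "nat list \<Rightarrow> chain_list" where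
  "contraction l = (case l of [] \<Rightarrow> [(1, [0])]
     | [v] \<Rightarrow> if v = 0 then [] else if v \<le> 9 then [(1, [0, v])]
         else (1, [0, 9]) # map (\<lambda>w. (1, [w, w + 1])) [9..<v]
     | _ \<Rightarrow> (case map_of fillings l of None \<Rightarrow> []
         | Some cs \<Rightarrow> filter (\<lambda>(c, t). c \<noteq> 0) (zip cs triangles)))"

definition core_positions :: "int4 list" where
  "core_positions = [
    (0,0,-2,1), (-2,1,2,-2), (0,-2,1,-1), (0,1,1,0), (-2,2,0,0), (-1,1,2,2), (1,2,0,1),
    (1,0,2,-2), (-2,-2,-2,1), (2,2,-2,-2)]"

definition position :: "nat \<Rightarrow> int4" where
  "position v = (if v < 10 then core_positions ! v else (int v - 7, 2, -2, -2))"

text \<open>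
  The first 32 hyperplanes separate the disjoint simplices on the vertices \<open>0, \<dots>, 9\<close>. Vertex \<open>9\<close> is the only one
  of these with the largest first coordinate, and the path continues in that direction, so
  hyperplanes orthogonal to it deal with the remaining pairs.
\<close>

definition hyperplanes :: "(int4 \<times> int) list" where
  "hyperplanes = [
    ((0,2,-1,1),1), ((1,0,1,0),0), ((1,3,3,0),6), ((2,-3,1,-1),-3), ((1,2,0,0),1),
    ((2,0,1,2),-1), ((3,-1,-1,1),-1), ((1,1,1,0),1), ((2,0,0,-1),0), ((0,0,3,4),-2),
    ((1,1,-2,0),-4), ((2,2,3,-1),4), ((2,-2,0,1),-2), ((6,-1,1,3),0), ((1,-1,2,-2),-3),
    ((0,1,0,1),0), ((1,-1,0,0),-1), ((0,2,-1,-2),1), ((1,-1,1,2),0), ((1,0,0,0),-1),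
    ((0,1,-1,-1),0), ((0,2,-1,-1),0), ((0,3,0,1),3), ((1,1,1,3),-4), ((2,-1,2,1),-4),
    ((1,0,3,5),-3), ((0,3,0,-1),2), ((0,3,0,1),5), ((3,-1,1,1),0), ((3,2,-1,-3),-2),
    ((5,-2,1,3),1), ((4,2,-7,-7),-5)]
    @ map (\<lambda>k. ((1,0,0,0), int k)) [1..<15]"

text \<open>
  A homomorphism of the fundamental group onto the alternating group on \<open>{0, \<dots>, 4}\<close>, read off along edges. The
  spanning tree of edges at \<open>0\<close> and the path carry the identity, as does every edge that is not listed.
  Only the direction of increasing vertices is listed.
\<close>

definition monodromy_table :: "(nat \<times> (nat \<times> nat list) list) list" where
  "monodromy_table = [
    (1,[
      (2,[3,0,4,2,1]), (5,[1,2,3,4,0]), (6,[2,4,1,0,3]), (7,[1,2,3,4,0]), (8,[2,4,3,1,0]),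
      (9,[3,0,4,2,1])]),
    (2,[
      (3,[2,0,4,1,3]), (5,[2,0,4,1,3]), (6,[1,4,3,0,2]), (7,[3,2,0,4,1]), (8,[3,2,0,4,1])]),
    (3,[
      (4,[1,3,0,4,2]), (6,[2,4,1,0,3]), (8,[2,4,3,1,0]), (9,[2,4,1,0,3])]),
    (4,[
      (5,[1,2,3,4,0]), (9,[1,2,3,4,0])]),
    (5,[
      (6,[4,0,1,2,3])]),
    (6,[
      (7,[4,3,1,0,2])]),
    (7,[
      (9,[2,4,1,0,3])]),
    (8,[
      (9,[1,2,3,4,0])])]"

definition find_perm :: "nat \<Rightarrow> nat \<Rightarrow> nat list option" where
  "find_perm u v = (case map_of monodromy_table u of None \<Rightarrow> None | Some ps \<Rightarrow> map_of ps v)"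

definition inverse_perm :: "nat list \<Rightarrow> nat list" where
  "inverse_perm p = map (\<lambda>j. length (takeWhile (\<lambda>x. x \<noteq> j) p)) [0..<5]"

definition perm :: "nat \<Rightarrow> nat \<Rightarrow> nat list" where
  "perm u v = (if u = v then [0..<5] else
     case find_perm u v of Some p \<Rightarrow> p
     | None \<Rightarrow> (case find_perm v u of Some p \<Rightarrow> inverse_perm p | None \<Rightarrow> [0..<5]))"

section \<open>Evaluating the certificates\<close>

lemma subfaces_of_facets:
  "list_all (\<lambda>l. list_all (\<lambda>m. m = [] \<or> m \<in> set nonempty_faces) (subseqs l)) facets"
  by code_simp

lemma nonempty_faces_shape:
  "list_all (\<lambda>l. l \<noteq> [] \<and> sorted_wrt (<) l \<and> length l \<le> 3 \<and> list_all (\<lambda>v. v < 23) l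
     \<and> list_ex (\<lambda>m. set l \<subseteq> set m) facets) nonempty_faces"
  by code_simp

lemma faces_separated:
  "all_separated (side_masks (map (\<lambda>v. (v, position v)) [0..<23]) hyperplanes)
     (map mask_of nonempty_faces)"
  by code_simp

lemma faces_contract: "list_all (contracts contraction) faces"
  by code_simp

lemma faces_raise: "list_all (raises_degree faces contraction) faces"
  by code_simp

lemma perm_cocycle:
  "list_all (\<lambda>f. list_all (\<lambda>u. list_all (\<lambda>v. list_all (\<lambda>w.
     map (nth (perm v w)) (perm u v) = perm u w) f) f) f) facets"
  by code_simp

lemma monodromy_table_perms:
  "list_all (\<lambda>(u, ps). list_all (\<lambda>(v, p). length p = 5 \<and> list_all (\<lambda>i. i < 5) p
     \<and> list_all (\<lambda>i. i \<in> set p) [0..<5]) ps) monodromy_table"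
  by code_simp

text \<open>
  The closed edge path \<open>0, 1, 2, 0\<close> moves every point of the fibre.
\<close>

lemma monodromy_loop: "list_all (\<lambda>i. perm 2 0 ! (perm 1 2 ! (perm 0 1 ! i)) \<noteq> i) [0..<5]"
  by code_simp

lemma loop_edges: "list_all (\<lambda>l. l \<in> set faces) [[0, 1], [1, 2], [0, 2], [0, 1, 3]]"
  by code_simp

section \<open>The properties of the complex\<close>

lemma sorted_faces: "l \<in> set faces \<Longrightarrow> sorted_wrt (<) l"
  using nonempty_faces_shape by (auto simp: faces_def list_all_iff)

lemma simplex_in_facet:
  assumes "\<sigma> \<in> example_complex"
  obtains l where "l \<in> set facets" "\<sigma> \<subseteq> set l"
proof -
  from assms obtain m where m: "m \<in> set faces" "\<sigma> = set m" by (auto simp: example_complex_def)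
  have "\<exists>l\<in>set facets. \<sigma> \<subseteq> set l"
  proof (cases "m = []")
    case True
    then show ?thesis using m by (auto simp: facets_def triangles_def)
  next
    case False
    then show ?thesis using m nonempty_faces_shape
      by (auto simp: faces_def list_all_iff list_ex_iff)
  qed
  then show thesis using that by blast
qed

lemma subset_of_facet:
  assumes "l \<in> set facets" "\<sigma> \<subseteq> set l"
  shows "\<sigma> \<in> example_complex"
proof -
  from assms(2) obtain m where m: "m \<in> set (subseqs l)" "\<sigma> = set m"
    using subseqs_powset[of l] by (metis PowI imageE)
  then show ?thesis
    using subfaces_of_facets assms(1) by (auto simp: example_complex_def faces_def list_all_iff)
qed

lemma complex_example_complex: "abstract_simplicial_complex example_complex"
  unfolding abstract_simplicial_complex_def
proof (intro conjI ballI allI impI)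
  show "example_complex \<noteq> {}" by (simp add: example_complex_def faces_def)
  show "finite \<sigma>" if "\<sigma> \<in> example_complex" for \<sigma> using that by (auto simp: example_complex_def)
  show "\<tau> \<in> example_complex" if "\<sigma> \<in> example_complex" "\<tau> \<subseteq> \<sigma>" for \<sigma> \<tau>
  proof -
    from that(1) obtain l where "l \<in> set facets" "\<sigma> \<subseteq> set l" by (rule simplex_in_facet)
    then show ?thesis using subset_of_facet that(2) by blast
  qed
qed

lemma finite_example_complex: "finite_simplicial_complex example_complex"
  using complex_example_complex by (simp add: finite_simplicial_complex_def example_complex_def)

lemma vertices_example_complex: "vertices example_complex = {..<23}"
proof
  show "vertices example_complex \<subseteq> {..<23}"
    using nonempty_faces_shape
    by (auto simp: vertices_def example_complex_def faces_def list_all_iff)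
  show "{..<23} \<subseteq> vertices example_complex"
  proof
    fix v :: nat assume "v \<in> {..<23}"
    then have "[v] \<in> set faces" by (auto simp: faces_def nonempty_faces_def)
    then show "v \<in> vertices example_complex" by (force simp: vertices_def example_complex_def)
  qed
qed

lemma complex_dim_example_complex: "complex_dim example_complex = 2"
  unfolding complex_dim_def
proof (rule Max_eqI)
  show "finite (simplex_dim ` example_complex)" by (simp add: example_complex_def)
  show "d \<le> 2" if "d \<in> simplex_dim ` example_complex" for d
  proof -
    from that obtain l where l: "l \<in> set faces" "d = simplex_dim (set l)"
      by (auto simp: example_complex_def)
    have "length l \<le> 3" using l nonempty_faces_shape by (auto simp: faces_def list_all_iff)
    then show ?thesis using card_length[of l] by (simp add: l simplex_dim_def)
  qed
  have "set [0, 1, 3] \<in> example_complex"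
    unfolding example_complex_def by (rule imageI) (use loop_edges in simp)
  moreover have "simplex_dim (set [0, 1, 3 :: nat]) = 2" by (simp add: simplex_dim_def)
  ultimately show "2 \<in> simplex_dim ` example_complex" by (metis image_eqI)
qed

lemma Z_acyclic_example_complex: "Z_acyclic example_complex"
  unfolding example_complex_def
  by (rule Z_acyclic_if_contracts[of _ contraction])
    (use complex_example_complex sorted_faces faces_contract faces_raise in
      \<open>auto simp: example_complex_def list_all_iff\<close>)

lemma polyhedral_realization_example_complex:
  "polyhedral_realization example_complex (\<lambda>v. point (position v))"
  unfolding example_complex_def
proof (rule polyhedral_realization_if_all_separated)
  show "finite_simplicial_complex (set ` set faces)"
    using finite_example_complex by (simp add: example_complex_def)
  have "filter (\<lambda>l. l \<noteq> []) faces = nonempty_faces"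
    using nonempty_faces_shape by (simp add: faces_def list_all_iff filter_id_conv)
  then show "all_separated (side_masks (map (\<lambda>v. (v, position v)) [0..<23]) hyperplanes)
      (map mask_of (filter (\<lambda>l. l \<noteq> []) faces))"
    using faces_separated by simp
  show "set l \<subseteq> set [0..<23]" if "l \<in> set faces" for l
    using that nonempty_faces_shape by (auto simp: faces_def list_all_iff)
qed

lemma perm_bounds:
  shows length_perm: "length (perm u v) = 5" and set_perm: "set (perm u v) \<subseteq> {..<5}"
proof -
  have find: "length p = 5 \<and> set p = {..<5}" if "find_perm u v = Some p" for u v p
    using that monodromy_table_perms
    by (fastforce simp: find_perm_def list_all_iff split: option.splits dest!: map_of_SomeD)
  have inv: "length (inverse_perm p) = 5 \<and> set (inverse_perm p) \<subseteq> {..<5}"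
    if "length p = 5 \<and> set p = {..<5}" for p
  proof -
    have "length (takeWhile (\<lambda>x. x \<noteq> j) p) < 5" if "j < 5" for j
    proof -
      have "takeWhile (\<lambda>x. x \<noteq> j) p \<noteq> p"
        using that \<open>length p = 5 \<and> set p = {..<5}\<close> by (auto simp: takeWhile_eq_all_conv)
      then have "length (takeWhile (\<lambda>x. x \<noteq> j) p) \<noteq> length p"
        by (metis order_refl take_all takeWhile_eq_take)
      then show ?thesis
        using length_takeWhile_le[of "\<lambda>x. x \<noteq> j" p] \<open>length p = 5 \<and> set p = {..<5}\<close> by simp
    qed
    then show ?thesis by (auto simp: inverse_perm_def)
  qed
  have "length (perm u v) = 5 \<and> set (perm u v) \<subseteq> {..<5}"
    using find[of u v] find[of v u] inv by (auto simp: perm_def split: option.splits)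
  then show "length (perm u v) = 5" "set (perm u v) \<subseteq> {..<5}" by auto
qed

lemma not_contractible_example_complex: "\<not> contractible (geometric_realization example_complex)"
proof -
  let ?g = "\<lambda>u v i. perm u v ! i"
  obtain b :: "23 \<Rightarrow> nat" where b: "bij_betw b UNIV {..<23}"
    using finite_same_card_bij[of "UNIV :: 23 set" "{..<23::nat}"] by auto
  obtain c :: "115 \<Rightarrow> nat \<times> nat" where c: "bij_betw c UNIV ({..<23} \<times> {..<5})"
    using finite_same_card_bij[of "UNIV :: 115 set" "{..<23::nat} \<times> {..<5::nat}"] by auto
  show ?thesis
  proof (rule not_contractible_if_monodromy[where F = "{..<5}" and g = ?g])
    show "bij_betw b UNIV (vertices example_complex)"
      "bij_betw c UNIV (vertices example_complex \<times> {..<5})"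
      using b c by (simp_all add: vertices_example_complex)
    show "?g u v i \<in> {..<5}" if "i \<in> {..<5}" for u v i
      using that set_perm[of u v] length_perm[of u v] by (metis lessThan_iff nth_mem subsetD)
    show "?g v v i = i" if "i \<in> {..<5}" for v i
      using that by (simp add: perm_def)
    show "?g v w (?g u v i) = ?g u w i"
      if \<sigma>: "\<sigma> \<in> example_complex" "u \<in> \<sigma>" "v \<in> \<sigma>" "w \<in> \<sigma>" and i: "i \<in> {..<5}" for \<sigma> u v w i
    proof -
      from simplex_in_facet[OF \<sigma>(1)] obtain l where "l \<in> set facets" "\<sigma> \<subseteq> set l" .
      then have "map (nth (perm v w)) (perm u v) = perm u w"
        using perm_cocycle \<sigma>(2-4) unfolding list_all_iff by blast
      then show ?thesis using i length_perm by (metis lessThan_iff nth_map)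
    qed
    fix s :: "nat \<Rightarrow> nat"
    assume s: "\<forall>v\<in>vertices example_complex. s v \<in> {..<5}"
      and sec: "\<forall>u v. {u, v} \<in> example_complex \<longrightarrow> ?g u v (s u) = s v"
    have "set l \<in> example_complex" if "l \<in> {[0, 1], [1, 2], [0, 2]}" for l
      unfolding example_complex_def by (rule imageI) (use that loop_edges in auto)
    from this[of "[0, 1]"] this[of "[1, 2]"] this[of "[0, 2]"]
    have "{0, 1} \<in> example_complex" "{1, 2} \<in> example_complex" "{2, 0} \<in> example_complex"
      by (simp_all add: insert_commute)
    then have "perm 2 0 ! (perm 1 2 ! (perm 0 1 ! s 0)) = s 0" using sec by metis
    moreover have "s 0 < 5" using s by (simp add: vertices_example_complex)
    ultimately show False using monodromy_loop by (simp add: list_all_iff)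
  qed (auto simp: finite_example_complex lessThan_empty_iff)
qed

theorem mainTheorem1:
  shows "\<exists>(K :: nat set set) (p :: nat \<Rightarrow> real ^ 4).
    finite_simplicial_complex K \<and>
    complex_dim K = 2 \<and>
    card (vertices K) = 23 \<and>
    Z_acyclic K \<and>
    \<not> contractible (geometric_realization K) \<and>
    polyhedral_realization K p \<and>
    (\<forall>v\<in>vertices K. \<forall>j. p v $ j \<in> \<int>)"
  using finite_example_complex complex_dim_example_complex Z_acyclic_example_complex
    not_contractible_example_complex polyhedral_realization_example_complex point_Ints
  by (intro exI[of _ example_complex] exI[of _ "\<lambda>v. point (position v)"])
    (simp add: vertices_example_complex)

end
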